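(* Let $X$ be a heap, $\omega$ a congruence on $X$, $Y$ a subheap of $X$, and suppose $X=\omega\rtimes Y$. Fix an element $e\in Y$ and set $K:=[e]_\omega$. The following conditions are equivalent: (a) The subheap $Y$ of $X$ is normal. (b) $X$ is the (inner) direct product of heaps $K\times Y$, that is, the map $K\times Y\to X$, $(k,y)\mapsto[k,e,y]$, is a heap isomorphism, where $K\times Y$ has the componentwise ternary operation. (c) $[y,e,k]=[k,e,y]$ for every $y\in Y$ and every $k\in K$. (d) There is an idempotent heap endomorphism $g$ of $X$ whose image is $K$ and such that $g^{-1}(e)=Y$. (e) The heap morphism $\alpha\colon Y\to\mathrm{Aut}(K)$, $y\mapsto\alpha_y$, where $\alpha_y(k)=[y,e,[k,y,e]]$ for every $y\in Y$, $k\in K$, is constantly equal to the identity mapping of $K$.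
   Context: A heap is a set $X$ with a ternary operation $[x,y,z]$ such that $[[x,y,z],w,u]=[x,y,[z,w,u]]$, $[x,x,y]=y$ and $[x,y,y]=x$ for all $x,y,z,w,u\in X$. Heap morphisms are the maps preserving the ternary operation; a subheap is a subset closed under it; a congruence is an equivalence relation compatible with it. $[x]_\omega$ denotes the equivalence class of $x$ modulo $\omega$. A normal subheap of $X$ is a non-empty subheap $S$ such that $[[x,e,s],x,e]\in S$ for every $x\in X$ and all $e,s\in S$. For a congruence $\omega$ and a subheap $Y$ of $X$, $X=\omega\rtimes Y$ (inner semidirect product) means that $Y\cap[x]_\omega$ is a singleton for every $x\in X$. $\mathrm{Aut}(K)$ denotes the set of all heap automorphisms of $K$, regarded as a heap with $[f,g,h]=f\circ g^{-1}\circ h$. *)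

theory Defs
  imports "HOL-Algebra.Congruence" "HOL-Library.FuncSet"
begin

record 'a heap = "'a partial_object" +
  bracket :: "'a \<Rightarrow> 'a \<Rightarrow> 'a \<Rightarrow> 'a"  (\<open>\<langle>_, _, _\<rangle>\<index>\<close>)

locale heap =
  fixes X (structure)
  assumes bracket_closed [intro, simp]:
      "\<lbrakk>x \<in> carrier X; y \<in> carrier X; z \<in> carrier X\<rbrakk> \<Longrightarrow> \<langle>x, y, z\<rangle> \<in> carrier X"
    and bracket_assoc:
      "\<lbrakk>x \<in> carrier X; y \<in> carrier X; z \<in> carrier X; w \<in> carrier X; u \<in> carrier X\<rbrakk>
        \<Longrightarrow> \<langle>\<langle>x, y, z\<rangle>, w, u\<rangle> = \<langle>x, y, \<langle>z, w, u\<rangle>\<rangle>"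
    and bracket_left [simp]: "\<lbrakk>x \<in> carrier X; y \<in> carrier X\<rbrakk> \<Longrightarrow> \<langle>x, x, y\<rangle> = y"
    and bracket_right [simp]: "\<lbrakk>x \<in> carrier X; y \<in> carrier X\<rbrakk> \<Longrightarrow> \<langle>x, y, y\<rangle> = x"

definition heap_hom :: "('a, 'm) heap_scheme \<Rightarrow> ('b, 'n) heap_scheme \<Rightarrow> ('a \<Rightarrow> 'b) set" where
  "heap_hom A B = {f \<in> carrier A \<rightarrow> carrier B.
     \<forall>x\<in>carrier A. \<forall>y\<in>carrier A. \<forall>z\<in>carrier A.
       f (\<langle>x, y, z\<rangle>\<^bsub>A\<^esub>) = \<langle>f x, f y, f z\<rangle>\<^bsub>B\<^esub>}"

definition heap_iso :: "('a, 'm) heap_scheme \<Rightarrow> ('b, 'n) heap_scheme \<Rightarrow> ('a \<Rightarrow> 'b) set" where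
  "heap_iso A B = {f \<in> heap_hom A B. bij_betw f (carrier A) (carrier B)}"

text \<open>The empty set counts as a subheap; normal subheaps are required to be non-empty.\<close>

definition subheap :: "'a set \<Rightarrow> ('a, 'm) heap_scheme \<Rightarrow> bool" where
  "subheap S X \<longleftrightarrow> S \<subseteq> carrier X \<and> (\<forall>x\<in>S. \<forall>y\<in>S. \<forall>z\<in>S. \<langle>x, y, z\<rangle>\<^bsub>X\<^esub> \<in> S)"

definition normal_subheap :: "'a set \<Rightarrow> ('a, 'm) heap_scheme \<Rightarrow> bool" where
  "normal_subheap S X \<longleftrightarrow> S \<noteq> {} \<and> subheap S X \<and>
     (\<forall>x\<in>carrier X. \<forall>e\<in>S. \<forall>s\<in>S. \<langle>\<langle>x, e, s\<rangle>\<^bsub>X\<^esub>, x, e\<rangle>\<^bsub>X\<^esub> \<in> S)"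

definition heap_congruence :: "('a \<times> 'a) set \<Rightarrow> ('a, 'm) heap_scheme \<Rightarrow> bool" where
  "heap_congruence \<omega> X \<longleftrightarrow> equiv (carrier X) \<omega> \<and>
     (\<forall>x x' y y' z z'. (x, x') \<in> \<omega> \<and> (y, y') \<in> \<omega> \<and> (z, z') \<in> \<omega>
        \<longrightarrow> (\<langle>x, y, z\<rangle>\<^bsub>X\<^esub>, \<langle>x', y', z'\<rangle>\<^bsub>X\<^esub>) \<in> \<omega>)"

definition inner_semidirect :: "('a, 'm) heap_scheme \<Rightarrow> ('a \<times> 'a) set \<Rightarrow> 'a set \<Rightarrow> bool" where
  "inner_semidirect X \<omega> Y \<longleftrightarrow> heap_congruence \<omega> X \<and> subheap Y X \<and>
     (\<forall>x\<in>carrier X. is_singleton (Y \<inter> \<omega> `` {x}))"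

abbreviation subheap_of :: "'a heap \<Rightarrow> 'a set \<Rightarrow> 'a heap" where
  "subheap_of X S \<equiv> X\<lparr>carrier := S\<rparr>"

definition prod_heap :: "'a heap \<Rightarrow> 'b heap \<Rightarrow> ('a \<times> 'b) heap" where
  "prod_heap A B = \<lparr>carrier = carrier A \<times> carrier B,
     bracket = (\<lambda>(a, b) (a', b') (a'', b''). (\<langle>a, a', a''\<rangle>\<^bsub>A\<^esub>, \<langle>b, b', b''\<rangle>\<^bsub>B\<^esub>))\<rparr>"

text \<open>
  Automorphisms are represented by functions that are \<open>undefined\<close> outside the carrier,
  so that equality in this heap is equality of maps on \<open>carrier K\<close>.
\<close>

definition Aut_heap :: "'a heap \<Rightarrow> ('a \<Rightarrow> 'a) heap" where
  "Aut_heap K = \<lparr>carrier = heap_iso K K \<inter> extensional (carrier K),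
     bracket = (\<lambda>f g h. compose (carrier K) f
       (compose (carrier K) (\<lambda>x\<in>carrier K. inv_into (carrier K) g x) h))\<rparr>"

definition conj_action :: "'a heap \<Rightarrow> 'a set \<Rightarrow> 'a \<Rightarrow> 'a \<Rightarrow> 'a \<Rightarrow> 'a" where
  "conj_action X K e y = (\<lambda>k\<in>K. \<langle>y, e, \<langle>k, y, e\<rangle>\<^bsub>X\<^esub>\<rangle>\<^bsub>X\<^esub>)"

end

theory Submission
  imports Defs
begin

text \<open>
  Fixing \<open>e\<close> turns \<open>X\<close> into a group with product \<open>x \<cdot> y = [x, e, y]\<close> and bracket
  \<open>[x, y, z] = x \<cdot> y\<inverse> \<cdot> z\<close>, in which \<open>K\<close> is a normal subgroup with complement \<open>Y\<close>. If \<open>Y\<close> is normal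
  as well, the commutators of \<open>Y\<close> with \<open>K\<close> lie in \<open>K \<inter> Y = {e}\<close>, so \<open>Y\<close> and \<open>K\<close> commute
  elementwise; this is (c), and (e) says the same about conjugation. Commutation makes both
  \<open>(k, y) \<mapsto> k \<cdot> y\<close> and the projection \<open>k \<cdot> y \<mapsto> k\<close> morphisms, and the kernel of the latter is \<open>Y\<close>.
\<close>

section \<open>Word calculus in a heap\<close>

context heap
begin

text \<open>The middle slot is inverted, and inversion reverses the order of the word
  \<open>a * b^-1 * c\<close>.\<close>

lemma bracket_middle:
  assumes "x \<in> carrier X" "a \<in> carrier X" "b \<in> carrier X" "c \<in> carrier X" "y \<in> carrier X"
  shows "\<langle>x, \<langle>a, b, c\<rangle>, y\<rangle> = \<langle>x, c, \<langle>b, a, y\<rangle>\<rangle>"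
proof -
  \<comment> \<open>Inserting the trivial pair \<open>w, w\<close> with \<open>w\<close> the bracket
    of \<open>a, b, c\<close> lets the outer letters cancel against the first copy of
    \<open>w\<close>.\<close>
  have "\<langle>x, c, \<langle>b, a, y\<rangle>\<rangle> = \<langle>x, c, \<langle>b, a, \<langle>\<langle>a, b, c\<rangle>, \<langle>a, b, c\<rangle>, y\<rangle>\<rangle>\<rangle>"
    using assms by simp
  also have "\<dots> = \<langle>\<langle>x, c, \<langle>b, a, \<langle>a, b, c\<rangle>\<rangle>\<rangle>, \<langle>a, b, c\<rangle>, y\<rangle>"
    using assms by (simp only: bracket_assoc bracket_closed)
  also have "\<langle>b, a, \<langle>a, b, c\<rangle>\<rangle> = c"
    using assms by (simp flip: bracket_assoc)
  finally show ?thesis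
    using assms by simp
qed

lemma bracket_cancel:
  assumes "x \<in> carrier X" "y \<in> carrier X" "z \<in> carrier X" "w \<in> carrier X"
  shows "\<langle>x, y, \<langle>y, z, w\<rangle>\<rangle> = \<langle>x, z, w\<rangle>"
  using assms by (simp flip: bracket_assoc)

text \<open>
  Read left to right, these rules turn a heap term into the reduced word
  \<open>x\<^sub>0 x\<^sub>1\<inverse> x\<^sub>2 \<dots>\<close> of the corresponding group element, so they decide the word problem.
\<close>
lemmas bracket_word = bracket_assoc bracket_middle bracket_cancel

end

section \<open>The semidirect product and its two components\<close>

locale semidirect_heap = heap X for X :: "'a heap" (structure) +
  fixes \<omega> :: "('a \<times> 'a) set" and Y K :: "'a set" and e :: 'a
  assumes congruence: "heap_congruence \<omega> X"
    and semidirect: "inner_semidirect X \<omega> Y"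
    and base: "e \<in> Y"
    and K_def: "K = \<omega> `` {e}"
begin

lemma \<omega>_equiv: "equiv (carrier X) \<omega>"
  using congruence by (simp add: heap_congruence_def)

lemma \<omega>_refl: "x \<in> carrier X \<Longrightarrow> (x, x) \<in> \<omega>"
  using \<omega>_equiv by (simp add: equiv_def refl_on_def)

lemma \<omega>_sym: "(x, y) \<in> \<omega> \<Longrightarrow> (y, x) \<in> \<omega>"
  using \<omega>_equiv by (auto simp: equiv_def dest: symD)

lemma \<omega>_trans: "(x, y) \<in> \<omega> \<Longrightarrow> (y, z) \<in> \<omega> \<Longrightarrow> (x, z) \<in> \<omega>"
  using \<omega>_equiv by (auto simp: equiv_def dest: transD)

lemma \<omega>_carrier: "(x, y) \<in> \<omega> \<Longrightarrow> x \<in> carrier X \<and> y \<in> carrier X"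
  using equiv_type[OF \<omega>_equiv] by auto

lemma \<omega>_bracket:
  "\<lbrakk>(x, x') \<in> \<omega>; (y, y') \<in> \<omega>; (z, z') \<in> \<omega>\<rbrakk> \<Longrightarrow> (\<langle>x, y, z\<rangle>, \<langle>x', y', z'\<rangle>) \<in> \<omega>"
  using congruence unfolding heap_congruence_def by blast

lemma Y_carrier [simp]: "y \<in> Y \<Longrightarrow> y \<in> carrier X"
  using semidirect by (auto simp: inner_semidirect_def subheap_def)

lemma Y_bracket [simp]: "\<lbrakk>x \<in> Y; y \<in> Y; z \<in> Y\<rbrakk> \<Longrightarrow> \<langle>x, y, z\<rangle> \<in> Y"
  using semidirect by (auto simp: inner_semidirect_def subheap_def)

lemma base_carrier [simp]: "e \<in> carrier X"
  using base by simp

lemma K_iff: "k \<in> K \<longleftrightarrow> (k, e) \<in> \<omega>"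
  unfolding K_def using \<omega>_sym by blast

lemma K_carrier [simp]: "k \<in> K \<Longrightarrow> k \<in> carrier X"
  using K_iff \<omega>_carrier by blast

lemma base_K [simp]: "e \<in> K"
  by (simp add: K_iff \<omega>_refl)

lemma K_bracket [simp]: "\<lbrakk>x \<in> K; y \<in> K; z \<in> K\<rbrakk> \<Longrightarrow> \<langle>x, y, z\<rangle> \<in> K"
  using \<omega>_bracket[of x e y e z e] by (simp add: K_iff)

lemma Y_unique: "\<lbrakk>y \<in> Y; y' \<in> Y; (y, y') \<in> \<omega>\<rbrakk> \<Longrightarrow> y = y'"
proof -
  assume *: "y \<in> Y" "y' \<in> Y" "(y, y') \<in> \<omega>"
  then have "is_singleton (Y \<inter> \<omega> `` {y})"
    using semidirect by (simp add: inner_semidirect_def)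
  moreover have "y \<in> Y \<inter> \<omega> `` {y}" "y' \<in> Y \<inter> \<omega> `` {y}"
    using * \<omega>_refl by auto
  ultimately show "y = y'"
    by (metis is_singletonE singletonD)
qed

text \<open>This is the quotient map of \<open>\<omega>\<close>, with the elements of
  \<open>Y\<close> as representatives of the classes.\<close>

definition proj :: "'a \<Rightarrow> 'a" where
  "proj x = (THE y. y \<in> Y \<and> (x, y) \<in> \<omega>)"

lemma proj:
  assumes "x \<in> carrier X"
  shows "proj x \<in> Y" and "(x, proj x) \<in> \<omega>"
proof -
  have "is_singleton (Y \<inter> \<omega> `` {x})"
    using semidirect assms by (simp add: inner_semidirect_def)
  then obtain y where "y \<in> Y" "(x, y) \<in> \<omega>"
    by (auto elim!: is_singletonE)
  then have "\<exists>!y. y \<in> Y \<and> (x, y) \<in> \<omega>"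
    using Y_unique \<omega>_sym \<omega>_trans by blast
  from theI'[OF this] show "proj x \<in> Y" "(x, proj x) \<in> \<omega>"
    by (simp_all add: proj_def)
qed

lemma proj_carrier [simp]: "x \<in> carrier X \<Longrightarrow> proj x \<in> carrier X"
  by (simp add: proj)

lemma proj_eqI: "\<lbrakk>y \<in> Y; (x, y) \<in> \<omega>\<rbrakk> \<Longrightarrow> proj x = y"
  using proj[of x] Y_unique \<omega>_carrier \<omega>_sym \<omega>_trans by blast

text \<open>The bracket of the representatives lies in \<open>Y\<close> and in the right class, so
  uniqueness identifies it.\<close>

lemma proj_bracket:
  "\<lbrakk>x \<in> carrier X; y \<in> carrier X; z \<in> carrier X\<rbrakk>
    \<Longrightarrow> proj \<langle>x, y, z\<rangle> = \<langle>proj x, proj y, proj z\<rangle>"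
  by (intro proj_eqI) (simp_all add: proj \<omega>_bracket)

text \<open>The \<open>K\<close>-component \<open>x * (proj x)^-1\<close> of \<open>x\<close>; it
  becomes the witness \<open>g\<close> in (d).\<close>

definition retract :: "'a \<Rightarrow> 'a" where
  "retract x = \<langle>x, proj x, e\<rangle>"

lemma retract_K: "x \<in> carrier X \<Longrightarrow> retract x \<in> K"
  using \<omega>_bracket[OF proj(2) \<omega>_refl \<omega>_refl, of x "proj x" e]
  by (simp add: K_iff retract_def)

lemma retract_decomp: "x \<in> carrier X \<Longrightarrow> \<langle>retract x, e, proj x\<rangle> = x"
  by (simp add: retract_def bracket_word)

lemma retract_on_K: "k \<in> K \<Longrightarrow> retract k = k"
  using proj_eqI[OF base, of k] by (simp add: K_iff retract_def \<omega>_carrier)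

lemma retract_eq_base_iff:
  assumes "x \<in> carrier X"
  shows "retract x = e \<longleftrightarrow> x \<in> Y"
proof
  assume "retract x = e"
  then show "x \<in> Y"
    using retract_decomp[OF assms] proj[OF assms] by simp
next
  assume "x \<in> Y"
  then show "retract x = e"
    using proj_eqI[of x x] assms by (simp add: retract_def \<omega>_refl)
qed

section \<open>Conjugation on \<open>K\<close>\<close>

lemma conj_mem_K:
  assumes "y \<in> carrier X" "k \<in> K"
  shows "\<langle>y, e, \<langle>k, y, e\<rangle>\<rangle> \<in> K"
proof -
  \<comment> \<open>Modulo \<open>\<omega>\<close>, \<open>k\<close> may be replaced by the neutral
    element \<open>e\<close>, and the conjugate of \<open>e\<close> is \<open>e\<close>.\<close>
  have "(\<langle>y, e, \<langle>k, y, e\<rangle>\<rangle>, \<langle>y, e, \<langle>e, y, e\<rangle>\<rangle>) \<in> \<omega>"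
    using assms by (intro \<omega>_bracket \<omega>_refl) (simp_all add: K_iff)
  then show ?thesis
    using assms by (simp add: K_iff bracket_word)
qed

text \<open>Here \<open>k\<close> is conjugated by \<open>y^-1\<close>, which gives the inverse of
  the action of \<open>y\<close>.\<close>

lemma conj_inverse_mem_K:
  assumes "y \<in> carrier X" "k \<in> K"
  shows "\<langle>e, y, \<langle>k, e, y\<rangle>\<rangle> \<in> K"
proof -
  have "(\<langle>e, y, \<langle>k, e, y\<rangle>\<rangle>, \<langle>e, y, \<langle>e, e, y\<rangle>\<rangle>) \<in> \<omega>"
    using assms by (intro \<omega>_bracket \<omega>_refl) (simp_all add: K_iff)
  then show ?thesis
    using assms by (simp add: K_iff)
qed

lemma conj_action_apply: "k \<in> K \<Longrightarrow> conj_action X K e y k = \<langle>y, e, \<langle>k, y, e\<rangle>\<rangle>"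
  by (simp add: conj_action_def)

lemma conj_action_bij:
  assumes "y \<in> carrier X"
  shows "bij_betw (conj_action X K e y) K K"
proof (rule bij_betwI)
  show "conj_action X K e y \<in> K \<rightarrow> K"
    using assms by (simp add: conj_action_apply conj_mem_K)
  show "(\<lambda>k. \<langle>e, y, \<langle>k, e, y\<rangle>\<rangle>) \<in> K \<rightarrow> K"
    using assms by (simp add: conj_inverse_mem_K)
qed (use assms in \<open>simp_all add: conj_action_apply conj_mem_K conj_inverse_mem_K bracket_word\<close>)

text \<open>Turns the \<open>inv_into\<close> from \<open>Aut_heap\<close> into a heap word, so that
  \<open>bracket_word\<close> applies.\<close>

lemma conj_action_inv_into:
  assumes "y \<in> carrier X" "k \<in> K"
  shows "inv_into K (conj_action X K e y) k = \<langle>e, y, \<langle>k, e, y\<rangle>\<rangle>"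
proof (rule inv_into_f_eq)
  show "inj_on (conj_action X K e y) K"
    using conj_action_bij[OF assms(1)] by (rule bij_betw_imp_inj_on)
qed (use assms in \<open>simp_all add: conj_action_apply conj_inverse_mem_K bracket_word\<close>)

lemma conj_action_Aut:
  assumes "y \<in> carrier X"
  shows "conj_action X K e y \<in> carrier (Aut_heap (subheap_of X K))"
  using assms conj_action_bij[OF assms]
  by (auto simp: Aut_heap_def heap_iso_def heap_hom_def conj_action_apply conj_mem_K bracket_word)
     (simp add: conj_action_def)

lemma conj_action_hom:
  "conj_action X K e \<in> heap_hom (subheap_of X Y) (Aut_heap (subheap_of X K))"
proof -
  have "conj_action X K e \<langle>x, y, z\<rangle> =
      \<langle>conj_action X K e x, conj_action X K e y, conj_action X K e z\<rangle>\<^bsub>Aut_heap (subheap_of X K)\<^esub>"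
    (is "?l = ?r")
    if "x \<in> Y" "y \<in> Y" "z \<in> Y" for x y z
  proof (rule extensionalityI)
    show "?l \<in> extensional K" "?r \<in> extensional K"
      by (simp_all add: conj_action_def Aut_heap_def compose_def)
    \<comment> \<open>The composite is evaluated from the inside out; each intermediate value must
      lie in \<open>K\<close> before the next map can be unfolded.\<close>
    show "?l k = ?r k" if "k \<in> K" for k
      using that \<open>x \<in> Y\<close> \<open>y \<in> Y\<close> \<open>z \<in> Y\<close> conj_mem_K[of z k]
        conj_inverse_mem_K[OF _ conj_mem_K, of y z k]
      by (simp add: Aut_heap_def compose_def conj_action_inv_into conj_action_apply)
         (simp add: bracket_word)
  qed
  then show ?thesis
    by (simp add: heap_hom_def conj_action_Aut)
qed

section \<open>Commutation of \<open>Y\<close> with \<open>K\<close> and the other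
  conditions\<close>

lemma normal_imp_commute:
  assumes "normal_subheap Y X" "y \<in> Y" "k \<in> K"
  shows "\<langle>y, e, k\<rangle> = \<langle>k, e, y\<rangle>"
proof -
  \<comment> \<open>The commutator \<open>y * k * y^-1 * k^-1\<close>.\<close>
  let ?c = "\<langle>y, e, \<langle>\<langle>k, y, e\<rangle>, k, e\<rangle>\<rangle>"
  \<comment> \<open>Normality of \<open>Y\<close> is applied to \<open>y^-1\<close>, written as the
    bracket of \<open>e, y, e\<close>, conjugated by \<open>k\<close>.\<close>
  have "\<langle>\<langle>k, e, \<langle>e, y, e\<rangle>\<rangle>, k, e\<rangle> \<in> Y"
    using assms base unfolding normal_subheap_def by simp
  then have "\<langle>\<langle>k, y, e\<rangle>, k, e\<rangle> \<in> Y"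
    using assms by (simp add: bracket_word)
  then have "?c \<in> Y"
    using assms base by simp
  \<comment> \<open>Regrouped as \<open>(y * k * y^-1) * k^-1\<close>, the commutator is a product
    of elements of \<open>K\<close>.\<close>
  moreover have "?c = \<langle>\<langle>y, e, \<langle>k, y, e\<rangle>\<rangle>, k, e\<rangle>"
    using assms by (simp add: bracket_word)
  then have "(?c, e) \<in> \<omega>"
    using assms conj_mem_K[of y k] by (simp flip: K_iff)
  ultimately have "?c = e"
    using Y_unique base by blast
  \<comment> \<open>Multiplying the commutator by \<open>k * y\<close> on the right yields
    \<open>y * k\<close>.\<close>
  then have "\<langle>?c, e, \<langle>k, e, y\<rangle>\<rangle> = \<langle>k, e, y\<rangle>"
    using assms by simp
  then show ?thesis
    using assms by (simp add: bracket_word)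
qed

text \<open>Right multiplication by \<open>y^-1\<close> leads from the first equation to the second,
  and by \<open>y\<close> back.\<close>

lemma commute_iff_conj_fixes:
  assumes "y \<in> carrier X" "k \<in> K"
  shows "\<langle>y, e, k\<rangle> = \<langle>k, e, y\<rangle> \<longleftrightarrow> \<langle>y, e, \<langle>k, y, e\<rangle>\<rangle> = k"
proof
  assume "\<langle>y, e, k\<rangle> = \<langle>k, e, y\<rangle>"
  then have "\<langle>\<langle>y, e, k\<rangle>, y, e\<rangle> = \<langle>\<langle>k, e, y\<rangle>, y, e\<rangle>"
    by simp
  then show "\<langle>y, e, \<langle>k, y, e\<rangle>\<rangle> = k"
    using assms by (simp add: bracket_word)
next
  assume "\<langle>y, e, \<langle>k, y, e\<rangle>\<rangle> = k"
  then have "\<langle>\<langle>y, e, \<langle>k, y, e\<rangle>\<rangle>, e, y\<rangle> = \<langle>k, e, y\<rangle>"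
    by simp
  then show "\<langle>y, e, k\<rangle> = \<langle>k, e, y\<rangle>"
    using assms by (simp add: bracket_word)
qed

lemma commute_iff_conj_action_trivial:
  "(\<forall>y\<in>Y. \<forall>k\<in>K. \<langle>y, e, k\<rangle> = \<langle>k, e, y\<rangle>) \<longleftrightarrow> (\<forall>y\<in>Y. conj_action X K e y = (\<lambda>k\<in>K. k))"
proof -
  have "conj_action X K e y = (\<lambda>k\<in>K. k) \<longleftrightarrow> (\<forall>k\<in>K. \<langle>y, e, \<langle>k, y, e\<rangle>\<rangle> = k)" for y
    by (auto simp: conj_action_def restrict_def fun_eq_iff)
  then show ?thesis
    by (simp add: commute_iff_conj_fixes)
qed

text \<open>Unique factorization of \<open>X\<close> as \<open>K * Y\<close>, with inverse given by
  \<open>retract\<close> and \<open>proj\<close>. What (b) adds is compatibility with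
  brackets.\<close>

lemma product_map_bij: "bij_betw (\<lambda>(k, y). \<langle>k, e, y\<rangle>) (K \<times> Y) (carrier X)"
proof (rule bij_betwI)
  show "(\<lambda>(k, y). \<langle>k, e, y\<rangle>) \<in> K \<times> Y \<rightarrow> carrier X"
    by auto
  show "(\<lambda>x. (retract x, proj x)) \<in> carrier X \<rightarrow> K \<times> Y"
    by (simp add: retract_K proj)
  show "(\<lambda>(k, y). \<langle>k, e, y\<rangle>) (retract x, proj x) = x" if "x \<in> carrier X" for x
    using that by (simp add: retract_decomp)
  show "(retract ((\<lambda>(k, y). \<langle>k, e, y\<rangle>) p), proj ((\<lambda>(k, y). \<langle>k, e, y\<rangle>) p)) = p"
    if p_mem: "p \<in> K \<times> Y" for p
  proof -
    obtain k y where p: "p = (k, y)" "k \<in> K" "y \<in> Y"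
      using p_mem by auto
    have "(\<langle>k, e, y\<rangle>, \<langle>e, e, y\<rangle>) \<in> \<omega>"
      using p by (intro \<omega>_bracket \<omega>_refl) (simp_all add: K_iff)
    then have "proj \<langle>k, e, y\<rangle> = y"
      using p by (intro proj_eqI) simp_all
    then show ?thesis
      using p by (simp add: retract_def bracket_word)
  qed
qed

lemma commute_iff_product:
  "(\<forall>y\<in>Y. \<forall>k\<in>K. \<langle>y, e, k\<rangle> = \<langle>k, e, y\<rangle>) \<longleftrightarrow>
    (\<lambda>(k, y). \<langle>k, e, y\<rangle>) \<in> heap_iso (prod_heap (subheap_of X K) (subheap_of X Y)) X"
  (is "?C \<longleftrightarrow> ?B")
proof
  assume C: ?C
  have "\<langle>\<langle>k, k', k''\<rangle>, e, \<langle>y, y', y''\<rangle>\<rangle> = \<langle>\<langle>k, e, y\<rangle>, \<langle>k', e, y'\<rangle>, \<langle>k'', e, y''\<rangle>\<rangle>"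
    if "k \<in> K" "k' \<in> K" "k'' \<in> K" "y \<in> Y" "y' \<in> Y" "y'' \<in> Y" for k k' k'' y y' y''
  proof -
    \<comment> \<open>The two sides of the goal differ only by swapping the inner blocks
      \<open>y * y'^-1\<close> and \<open>k'^-1 * k''\<close>.\<close>
    have "\<langle>\<langle>y, y', e\<rangle>, e, \<langle>e, k', k''\<rangle>\<rangle> = \<langle>\<langle>e, k', k''\<rangle>, e, \<langle>y, y', e\<rangle>\<rangle>"
      using C that base by simp
    then have "\<langle>\<langle>k, e, \<langle>\<langle>y, y', e\<rangle>, e, \<langle>e, k', k''\<rangle>\<rangle>\<rangle>, e, y''\<rangle> =
        \<langle>\<langle>k, e, \<langle>\<langle>e, k', k''\<rangle>, e, \<langle>y, y', e\<rangle>\<rangle>\<rangle>, e, y''\<rangle>"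
      by simp
    then show ?thesis
      using that by (simp add: bracket_word)
  qed
  then show ?B
    using product_map_bij by (auto simp: heap_iso_def heap_hom_def prod_heap_def)
next
  assume ?B
  then have hom: "\<langle>\<langle>k, k', k''\<rangle>, e, \<langle>y, y', y''\<rangle>\<rangle> = \<langle>\<langle>k, e, y\<rangle>, \<langle>k', e, y'\<rangle>, \<langle>k'', e, y''\<rangle>\<rangle>"
    if "k \<in> K" "k' \<in> K" "k'' \<in> K" "y \<in> Y" "y' \<in> Y" "y'' \<in> Y" for k k' k'' y y' y''
    using that by (simp add: heap_iso_def heap_hom_def prod_heap_def)
  show ?C
  proof (intro ballI)
    fix y k
    assume "y \<in> Y" "k \<in> K"
    then show "\<langle>y, e, k\<rangle> = \<langle>k, e, y\<rangle>"
      \<comment> \<open>The pairs \<open>(e, y)\<close>, \<open>(e, e)\<close>,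
        \<open>(k, e)\<close> multiply to \<open>y * k\<close> after the map and to
        \<open>k * y\<close> before it.\<close>
      using hom[of e e k y e e] base by simp
  qed
qed

text \<open>The \<open>K\<close>-component of a bracket is
  \<open>retract x * (q * m * q^-1)\<close>, with \<open>q\<close> in \<open>Y\<close> and
  \<open>m\<close> in \<open>K\<close>; commutation removes the conjugation by
  \<open>q\<close>.\<close>

lemma commute_imp_retract_hom:
  assumes C: "\<forall>y\<in>Y. \<forall>k\<in>K. \<langle>y, e, k\<rangle> = \<langle>k, e, y\<rangle>"
  shows "retract \<in> heap_hom X X"
proof -
  have "retract \<langle>x, y, z\<rangle> = \<langle>retract x, retract y, retract z\<rangle>"
    if xyz: "x \<in> carrier X" "y \<in> carrier X" "z \<in> carrier X" for x y z
  proof -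
    let ?q = "\<langle>proj x, proj y, e\<rangle>" and ?m = "\<langle>e, retract y, retract z\<rangle>"
    have "?q \<in> Y" "?m \<in> K"
      using xyz base by (simp_all add: proj retract_K)
    then have "\<langle>?q, e, \<langle>?m, ?q, e\<rangle>\<rangle> = ?m"
      using C commute_iff_conj_fixes[of ?q ?m] Y_carrier by blast
    then have "\<langle>retract x, e, \<langle>?q, e, \<langle>?m, ?q, e\<rangle>\<rangle>\<rangle> = \<langle>retract x, e, ?m\<rangle>"
      by simp
    moreover have "retract \<langle>x, y, z\<rangle> = \<langle>retract x, e, \<langle>?q, e, \<langle>?m, ?q, e\<rangle>\<rangle>\<rangle>"
      using xyz by (simp add: proj_bracket retract_def bracket_word)
    moreover have "\<langle>retract x, e, ?m\<rangle> = \<langle>retract x, retract y, retract z\<rangle>"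
      using xyz by (simp add: retract_K bracket_word)
    ultimately show ?thesis
      by simp
  qed
  then show ?thesis
    by (simp add: heap_hom_def retract_K)
qed

lemma commute_imp_retraction:
  assumes "\<forall>y\<in>Y. \<forall>k\<in>K. \<langle>y, e, k\<rangle> = \<langle>k, e, y\<rangle>"
  shows "\<exists>g \<in> heap_hom X X. (\<forall>x\<in>carrier X. g (g x) = g x) \<and> g ` carrier X = K
    \<and> {x \<in> carrier X. g x = e} = Y"
proof (intro bexI conjI)
  show "\<forall>x\<in>carrier X. retract (retract x) = retract x"
    by (simp add: retract_K retract_on_K)
  show "retract ` carrier X = K"
    using retract_K retract_on_K[symmetric] K_carrier by blast
  show "{x \<in> carrier X. retract x = e} = Y"
    using retract_eq_base_iff Y_carrier by blast
qed (rule commute_imp_retract_hom[OF assms])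

text \<open>As for kernels: \<open>g\<close> sends the conjugate to the bracket of
  \<open>g x, g x, e\<close>, which is \<open>e\<close>.\<close>

lemma fibre_normal:
  assumes g: "g \<in> heap_hom X X" and Y: "{x \<in> carrier X. g x = e} = Y"
  shows "normal_subheap Y X"
proof -
  have "\<langle>\<langle>x, d, s\<rangle>, x, d\<rangle> \<in> Y" if "x \<in> carrier X" "d \<in> Y" "s \<in> Y" for x d s
  proof -
    have "g d = e" "g s = e" "g x \<in> carrier X"
      using that Y g by (auto simp: heap_hom_def)
    then have "g \<langle>\<langle>x, d, s\<rangle>, x, d\<rangle> = e"
      using that g by (simp add: heap_hom_def)
    then show ?thesis
      using that unfolding Y[symmetric] by simp
  qed
  then show ?thesis
    using base semidirect by (auto simp: normal_subheap_def inner_semidirect_def)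
qed

end

theorem proposition5p5:
  fixes X :: "'a heap" and \<omega> :: "('a \<times> 'a) set" and Y K :: "'a set" and e :: 'a
  assumes "heap X"
    and "heap_congruence \<omega> X"
    and "subheap Y X"
    and "inner_semidirect X \<omega> Y"
    and "e \<in> Y"
    and "K = \<omega> `` {e}"
  defines "A \<equiv> normal_subheap Y X"
    and "B \<equiv> (\<lambda>(k, y). \<langle>k, e, y\<rangle>\<^bsub>X\<^esub>) \<in> heap_iso (prod_heap (subheap_of X K) (subheap_of X Y)) X"
    and "C \<equiv> \<forall>y\<in>Y. \<forall>k\<in>K. \<langle>y, e, k\<rangle>\<^bsub>X\<^esub> = \<langle>k, e, y\<rangle>\<^bsub>X\<^esub>"
    and "D \<equiv> \<exists>g \<in> heap_hom X X. (\<forall>x\<in>carrier X. g (g x) = g x) \<and> g ` carrier X = K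
                 \<and> {x \<in> carrier X. g x = e} = Y"
    and "E \<equiv> \<forall>y\<in>Y. conj_action X K e y = (\<lambda>k\<in>K. k)"
  shows "conj_action X K e \<in> heap_hom (subheap_of X Y) (Aut_heap (subheap_of X K))
    \<and> (A \<longleftrightarrow> B) \<and> (A \<longleftrightarrow> C) \<and> (A \<longleftrightarrow> D) \<and> (A \<longleftrightarrow> E)"
proof -
  interpret semidirect_heap X \<omega> Y K e
    using assms(1,2,4-6) by (simp add: semidirect_heap_def semidirect_heap_axioms_def)
  \<comment> \<open>The cycle A, C, D, A is closed first; B and E are then attached to C.\<close>
  have "A \<Longrightarrow> C"
    unfolding A_def C_def by (blast intro: normal_imp_commute)
  moreover have "C \<Longrightarrow> D"
    using commute_imp_retraction by (simp add: C_def D_def)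
  moreover have "D \<Longrightarrow> A"
    using fibre_normal by (auto simp: A_def D_def)
  moreover have "C \<longleftrightarrow> B"
    unfolding B_def C_def by (rule commute_iff_product)
  moreover have "C \<longleftrightarrow> E"
    unfolding C_def E_def by (rule commute_iff_conj_action_trivial)
  ultimately show ?thesis
    using conj_action_hom by blast
qed

end
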